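(* Let $p\in\mathbb N$, $A\ge0$ and $B\in\mathbb R$. For any polynomial $s\in\mathcal P_p([0,1])$, $$s^2(0)\le\big(2\lfloor(A+B_+)/4\rfloor+p+3\big)^2\int_0^1s^2(x)\,\mathrm e^{-(Ax^2+Bx)/2}\,\mathrm dx.$$
   Context: $\mathcal P_p([0,1])$ is the space of real univariate polynomials of degree at most $p$ on $[0,1]$; $\lfloor\cdot\rfloor$ is the integer part and $B_+=\max\{B,0\}$ the positive part. *)

theory Defs
  imports "HOL-Analysis.Analysis" "HOL-Computational_Algebra.Polynomial"
begin

end

theory Submission
  imports Defs
begin

text \<open>
  The unweighted inequality \<open>s(0)\<^sup>2 \<le> (n+1)\<^sup>2 \<integral> s\<^sup>2\<close> for degree at most \<open>n\<close> follows from the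
  Cauchy-Schwarz inequality and the reproducing kernel of evaluation at \<open>0\<close>, whose coefficients
  form the first row of the inverse Hilbert matrix. For the weight, put \<open>C = (A + B\<^sub>+)/4\<close> and
  \<open>k = \<lfloor>C\<rfloor> + 1\<close>: on \<open>[0,1]\<close> the weight is at least \<open>e\<^bsup>-2Cx\<^esup> \<ge> (1-x)\<^bsup>2k\<^esup>\<close>, so one applies the
  unweighted inequality to \<open>s(x) (1-x)\<^bsup>k\<^esup>\<close>, which has degree at most \<open>p + k\<close> and the same
  value at \<open>0\<close>.
\<close>

text \<open>Substituting \<open>x + 1\<close> for \<open>x\<close> preserves the degree and the
  leading coefficient, so the leading terms cancel.\<close>

lemma degree_diff_shift_less:
  fixes q :: "'a::idom poly"
  assumes "degree q > 0"
  shows "degree (q - pcompose q [:1, 1:]) < degree q"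
proof -
  have "degree (pcompose q [:1, 1:]) = degree q"
    by (simp add: degree_pcompose)
  moreover have "lead_coeff (pcompose q [:1, 1:]) = lead_coeff q"
    by (subst lead_coeff_comp) simp_all
  ultimately show ?thesis
    using assms by (intro degree_lessI) (auto simp: coeff_eq_0 le_less)
qed

text \<open>Up to sign this is an n-th finite difference. Pascal's rule turns the sum for
  \<open>q\<close> and \<open>Suc n\<close> into the sum for \<open>q(x) - q(x + 1)\<close> and
  \<open>n\<close>, and the degree drops along with \<open>n\<close>.\<close>

lemma alternating_binomial_sum_poly_eq_0:
  fixes q :: "'a::idom poly"
  assumes "degree q < n"
  shows "(\<Sum>k\<le>n. (-1) ^ k * of_nat (n choose k) * poly q (of_nat k)) = 0"
  using assms
proof (induction n arbitrary: q)
  case 0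
  then show ?case by simp
next
  case (Suc n)
  define r where "r = q - pcompose q [:1, 1:]"
  have "(\<Sum>k\<le>Suc n. (-1) ^ k * of_nat (Suc n choose k) * poly q (of_nat k)) =
      poly q 0 + (\<Sum>k\<le>n. (-1) ^ Suc k * of_nat (n choose Suc k) * poly q (of_nat (Suc k)))
        + (\<Sum>k\<le>n. (-1) ^ Suc k * of_nat (n choose k) * poly q (of_nat (Suc k)))"
    by (subst sum.atMost_Suc_shift) (simp add: algebra_simps sum.distrib sum_subtractf sum_negf)
  also have "poly q 0 + (\<Sum>k\<le>n. (-1) ^ Suc k * of_nat (n choose Suc k) * poly q (of_nat (Suc k)))
      = (\<Sum>k\<le>Suc n. (-1) ^ k * of_nat (n choose k) * poly q (of_nat k))"
    by (subst sum.atMost_Suc_shift) simp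
  also have "\<dots> = (\<Sum>k\<le>n. (-1) ^ k * of_nat (n choose k) * poly q (of_nat k))"
    by (simp add: binomial_eq_0)
  also have "\<dots> + (\<Sum>k\<le>n. (-1) ^ Suc k * of_nat (n choose k) * poly q (of_nat (Suc k)))
      = (\<Sum>k\<le>n. (-1) ^ k * of_nat (n choose k) * poly r (of_nat k))"
    by (simp add: r_def poly_pcompose algebra_simps flip: sum.distrib)
  also have "\<dots> = 0"
  \<comment> \<open>The degree drops strictly only from a positive value; for constant
    \<open>q\<close> the difference \<open>r\<close> is zero.\<close>
  proof (cases "degree q = 0")
    case True
    then obtain a where "q = [:a:]" by (rule degree_eq_zeroE)
    then have "r = 0" by (simp add: r_def)
    then show ?thesis by simp
  next
    case False
    then show ?thesis
      using Suc.prems degree_diff_shift_less[of q] by (intro Suc.IH) (simp add: r_def)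
  qed
  finally show ?case .
qed

text \<open>The product is left unevaluated so that its factor with \<open>m = i\<close> cancels the
  denominator \<open>i + j + 1\<close> of a Hilbert matrix entry.\<close>

definition hilbert_inv_coeff :: "nat \<Rightarrow> nat \<Rightarrow> real" where
  "hilbert_inv_coeff n j =
     (-1) ^ j * real (Suc n choose Suc j) * (\<Prod>m\<le>n. real (Suc j) + real m) / fact n"

lemma hilbert_inv_coeff_0: "hilbert_inv_coeff n 0 = (real n + 1)\<^sup>2"
proof -
  have "(\<Prod>m\<le>n. 1 + real m) = fact (Suc n)"
    by (induction n) (simp_all add: algebra_simps)
  then show ?thesis
    by (simp add: hilbert_inv_coeff_def power2_eq_square add.commute)
qed

text \<open>
  Up to sign the summand is \<open>(n+1 choose k) F(k)\<close> at \<open>k = j + 1\<close>, where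
  \<open>F(x) = \<Prod>m\<noteq>i. (x + m) / n!\<close> has degree \<open>n\<close>. Since the alternating sum over \<open>0 \<le> k \<le> n + 1\<close>
  vanishes, only the missing term \<open>F(0)\<close> remains.
\<close>
lemma sum_hilbert_inv_coeff:
  assumes "i \<le> n"
  shows "(\<Sum>j\<le>n. hilbert_inv_coeff n j / real (i + j + 1)) = (if i = 0 then 1 else 0)"
proof -
  define F :: "real poly" where "F = (\<Prod>m\<in>{..n} - {i}. [:real m, 1:])"
  have F: "poly F x = (\<Prod>m\<in>{..n} - {i}. x + real m)" for x
    by (simp add: F_def poly_prod add.commute)
  have "degree F \<le> n"
    using degree_prod_sum_le[of "{..n} - {i}" "\<lambda>m. [:real m, 1:]"] assms
    by (simp add: F_def)
  then have "(\<Sum>k\<le>Suc n. (-1) ^ k * real (Suc n choose k) * poly F (real k)) = 0"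
    by (intro alternating_binomial_sum_poly_eq_0) simp
  then have shifted: "(\<Sum>j\<le>n. (-1) ^ j * real (Suc n choose Suc j) * poly F (real (Suc j))) = poly F 0"
    by (subst (asm) sum.atMost_Suc_shift) (simp add: sum_negf del: binomial_Suc_Suc)
  have "hilbert_inv_coeff n j / real (i + j + 1) =
      (-1) ^ j * real (Suc n choose Suc j) * poly F (real (Suc j)) / fact n" for j
  proof -
    define d where "d = real (i + j + 1)"
    have "(\<Prod>m\<le>n. real (Suc j) + real m) = (real (Suc j) + real i) * poly F (real (Suc j))"
      unfolding F using assms by (intro prod.remove) auto
    also have "real (Suc j) + real i = d"
      by (simp add: d_def)
    finally show ?thesis
      unfolding hilbert_inv_coeff_def d_def[symmetric] by (simp add: d_def del: of_nat_add)
  qed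
  then have "(\<Sum>j\<le>n. hilbert_inv_coeff n j / real (i + j + 1)) = poly F 0 / fact n"
    by (simp only: shifted flip: sum_divide_distrib)
  \<comment> \<open>For \<open>i = 0\<close> the roots of \<open>F\<close> avoid 0 and
    \<open>F(0) = n!\<close>; otherwise the index \<open>m = 0\<close> contributes a factor
    \<open>x\<close>.\<close>
  also have "\<dots> = (if i = 0 then 1 else 0)"
  proof (cases "i = 0")
    case True
    have "{..n} - {0} = {1..n}" by auto
    then show ?thesis
      using True by (simp add: F fact_prod)
  next
    case False
    then have "poly F 0 = 0"
      using assms by (auto simp: F)
    then show ?thesis
      using False by simp
  qed
  finally show ?thesis .
qed

lemma has_integral_power_01: "((\<lambda>x::real. x ^ k) has_integral 1 / real (k + 1)) {0..1}"
proof -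
  have "((\<lambda>x::real. x ^ (k + 1) / real (k + 1)) has_real_derivative x ^ k) (at x within {0..1})" for x
    using DERIV_cdivide[OF DERIV_pow[of "k + 1" x "{0..1}"], of "real (k + 1)"] by simp
  then have "((\<lambda>x::real. x ^ k) has_integral 1 ^ (k + 1) / real (k + 1) - 0 ^ (k + 1) / real (k + 1)) {0..1}"
    by (intro fundamental_theorem_of_calculus[of 0 1 "\<lambda>x. x ^ (k + 1) / real (k + 1)"])
      (simp_all flip: has_real_derivative_iff_has_vector_derivative)
  then show ?thesis by simp
qed

text \<open>Integrating \<open>x ^ (i + j)\<close> yields the Hilbert matrix entry
  \<open>1 / (i + j + 1)\<close>, so summing over \<open>j\<close> first leaves only
  \<open>i = 0\<close>.\<close>

lemma hilbert_kernel_reproducing: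
  "((\<lambda>x. (\<Sum>i\<le>n. a i * x ^ i) * (\<Sum>j\<le>n. hilbert_inv_coeff n j * x ^ j)) has_integral a 0) {0..1}"
proof -
  have "((\<lambda>x. \<Sum>i\<le>n. \<Sum>j\<le>n. (a i * hilbert_inv_coeff n j) * x ^ (i + j)) has_integral
      (\<Sum>i\<le>n. \<Sum>j\<le>n. (a i * hilbert_inv_coeff n j) * (1 / real (i + j + 1)))) {0..1}"
    by (intro has_integral_sum has_integral_mult_right has_integral_power_01) simp_all
  moreover have "(\<Sum>i\<le>n. \<Sum>j\<le>n. (a i * hilbert_inv_coeff n j) * (1 / real (i + j + 1)))
      = (\<Sum>i\<le>n. a i * (\<Sum>j\<le>n. hilbert_inv_coeff n j / real (i + j + 1)))"
    by (simp add: sum_distrib_left)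
  moreover have "\<dots> = (\<Sum>i\<le>n. a i * (if i = 0 then 1 else 0))"
    by (intro sum.cong) (simp_all only: sum_hilbert_inv_coeff atMost_iff)
  moreover have "\<dots> = a 0"
    by (simp add: if_distrib cong: if_cong)
  ultimately show ?thesis
    by (simp add: sum_product power_add mult_ac)
qed

lemma poly_0_squared_le_integral:
  fixes s :: "real poly"
  assumes "degree s \<le> n"
  shows "(poly s 0)\<^sup>2 \<le> (real n + 1)\<^sup>2 * integral {0..1} (\<lambda>x. (poly s x)\<^sup>2)"
proof -
  define K where "K x = (\<Sum>j\<le>n. hilbert_inv_coeff n j * x ^ j)" for x
  define M where "M = (real n + 1)\<^sup>2"
  \<comment> \<open>This \<open>t\<close> minimizes the integral of
    \<open>(s - t K)\<^sup>2\<close>, whose nonnegativity gives the Cauchy-Schwarz bound.\<close>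
  define t where "t = poly s 0 / M"
  have "M > 0" by (simp add: M_def)
  have s: "poly s x = (\<Sum>i\<le>n. coeff s i * x ^ i)" for x
    unfolding poly_altdef
    by (intro sum.mono_neutral_left) (use assms in \<open>auto simp: coeff_eq_0\<close>)
  have sK: "((\<lambda>x. poly s x * K x) has_integral poly s 0) {0..1}"
    unfolding s K_def using hilbert_kernel_reproducing[where n = n and a = "coeff s"]
    by (simp add: poly_0_coeff_0)
  \<comment> \<open>The kernel reproduces itself: its squared norm is its own value at 0.\<close>
  have KK: "((\<lambda>x. K x * K x) has_integral M) {0..1}"
    unfolding K_def M_def using hilbert_kernel_reproducing[where n = n and a = "hilbert_inv_coeff n"]
    by (simp only: hilbert_inv_coeff_0)
  have ss: "((\<lambda>x. (poly s x)\<^sup>2) has_integral integral {0..1} (\<lambda>x. (poly s x)\<^sup>2)) {0..1}"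
    by (intro integrable_integral integrable_continuous_real continuous_intros)
  have "((\<lambda>x. (poly s x)\<^sup>2 - 2 * t * (poly s x * K x) + t\<^sup>2 * (K x * K x)) has_integral
      integral {0..1} (\<lambda>x. (poly s x)\<^sup>2) - 2 * t * poly s 0 + t\<^sup>2 * M) {0..1}"
    by (intro has_integral_add has_integral_diff has_integral_mult_right sK KK ss)
  moreover have "(poly s x)\<^sup>2 - 2 * t * (poly s x * K x) + t\<^sup>2 * (K x * K x) = (poly s x - t * K x)\<^sup>2" for x
    by (simp add: power2_eq_square algebra_simps)
  ultimately have "0 \<le> integral {0..1} (\<lambda>x. (poly s x)\<^sup>2) - 2 * t * poly s 0 + t\<^sup>2 * M"
    by (metis (no_types, lifting) has_integral_nonneg zero_le_power2)
  also have "\<dots> = integral {0..1} (\<lambda>x. (poly s x)\<^sup>2) - (poly s 0)\<^sup>2 / M"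
    using \<open>M > 0\<close> by (simp add: t_def power2_eq_square field_simps)
  finally show ?thesis
    using \<open>M > 0\<close> unfolding M_def[symmetric] by (simp add: field_simps)
qed

text \<open>Combine \<open>1 - x \<le> exp (- x)\<close> with \<open>x\<^sup>2 \<le> x\<close>,
  which bounds the exponent \<open>(A * x\<^sup>2 + B * x) / 2\<close> by
  \<open>2 * C * x\<close>.\<close>

lemma one_minus_power_le_exp_weight:
  fixes x A B C :: real
  assumes "A \<ge> 0" "x \<in> {0..1}" and C: "C = (A + max B 0) / 4" "C \<le> real k"
  shows "((1 - x) ^ k)\<^sup>2 \<le> exp (- (A * x\<^sup>2 + B * x) / 2)"
proof -
  have "(1 - x) ^ k \<le> exp (- x) ^ k"
    using assms exp_ge_add_one_self[of "- x"] by (intro power_mono) auto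
  also have "\<dots> = exp (- (real k * x))"
    by (simp flip: exp_of_nat_mult)
  finally have "((1 - x) ^ k)\<^sup>2 \<le> (exp (- (real k * x)))\<^sup>2"
    using assms by (intro power_mono) auto
  also have "\<dots> = exp (- (2 * real k * x))"
    by (simp add: power2_eq_square flip: exp_add)
  also have "\<dots> \<le> exp (- (A * x\<^sup>2 + B * x) / 2)"
  proof -
    have "A * x\<^sup>2 \<le> A * x"
      using assms by (intro mult_left_mono) (auto simp: power2_eq_square mult_left_le)
    moreover have "B * x \<le> max B 0 * x" "C * x \<le> real k * x"
      using assms by (auto intro: mult_right_mono)
    moreover have "4 * (C * x) = A * x + max B 0 * x"
      by (simp add: C algebra_simps)
    ultimately show ?thesis by simp
  qed
  finally show ?thesis .
qed

theorem theorem5p1: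
  fixes p :: nat and A B :: real and s :: "real poly"
  assumes "A \<ge> 0"
    and "degree s \<le> p"
  shows "(poly s 0)\<^sup>2 \<le>
    (2 * real_of_int \<lfloor>(A + max B 0) / 4\<rfloor> + real p + 3)\<^sup>2 *
      integral {0..1} (\<lambda>x. (poly s x)\<^sup>2 * exp (- (A * x\<^sup>2 + B * x) / 2))"
proof -
  define C where "C = (A + max B 0) / 4"
  define k where "k = nat \<lfloor>C\<rfloor> + 1"
  define q :: "real poly" where "q = s * [:1, - 1:] ^ k"
  have "C \<ge> 0" using assms(1) by (simp add: C_def)
  then have k: "real k = real_of_int \<lfloor>C\<rfloor> + 1" "real_of_int \<lfloor>C\<rfloor> \<ge> 0"
    by (simp_all add: k_def)
  have "C \<le> real k"
    unfolding k by linarith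
  have q: "poly q x = poly s x * (1 - x) ^ k" for x
    by (simp add: q_def poly_power)
  have "degree q \<le> p + k"
    using degree_mult_le[of s "[:1, - 1:] ^ k"] assms(2)
    by (simp add: q_def degree_power_eq)
  then have "(poly q 0)\<^sup>2 \<le> (real (p + k) + 1)\<^sup>2 * integral {0..1} (\<lambda>x. (poly q x)\<^sup>2)"
    by (rule poly_0_squared_le_integral)
  \<comment> \<open>Here \<open>p + k + 1 = \<lfloor>C\<rfloor> + p + 2\<close>, which is below the
    stated constant because \<open>\<lfloor>C\<rfloor> \<ge> 0\<close>.\<close>
  also have "\<dots> \<le> (2 * real_of_int \<lfloor>C\<rfloor> + real p + 3)\<^sup>2 *
      integral {0..1} (\<lambda>x. (poly s x)\<^sup>2 * exp (- (A * x\<^sup>2 + B * x) / 2))"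
  proof (intro mult_mono power_mono integral_le)
    show "(poly q x)\<^sup>2 \<le> (poly s x)\<^sup>2 * exp (- (A * x\<^sup>2 + B * x) / 2)" if "x \<in> {0..1}" for x
      unfolding q power_mult_distrib
      using one_minus_power_le_exp_weight[OF assms(1) that C_def \<open>C \<le> real k\<close>]
      by (intro mult_left_mono) simp_all
  qed (use k in \<open>auto intro!: integrable_continuous_real integral_nonneg continuous_intros\<close>)
  finally show ?thesis
    by (simp add: q C_def)
qed

end
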